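(* Let $c(G)$ be any chordal extension of $G$. Then $\mathbb V\sqsubseteq\mathbb W^+\simeq\mathbb W_{c(G)}^+\sqsubseteq\mathbb W_G^+$. If $G$ is a tree, then $\mathbb V\sqsubseteq\mathbb W^+\simeq\mathbb W_{c(G)}^+\simeq\mathbb W_G^+$.
   Context: $G=(N^+,E)$, $N^+=\{0,\dots,n\}$, is a connected undirected simple graph with a nonzero complex admittance $y_{jk}=y_{kj}$ on each edge. For complex numbers, $a\le b$ means inequality of both real and imaginary parts. Given are bounds $\underline v_j\le\overline v_j$ with $\underline v_j>0$ and complex bounds $\underline s_j,\overline s_j$ (possibly infinite), $j\in N^+$; for the slack bus $\underline v_0=\overline v_0=1$ and the bounds on $s_0$ are infinite (no constraint). $\mathbb V$ is the set of $V\in\mathbb C^{n+1}$ with $V_0=1$ such that for all $j\in N^+$: $\underline v_j\le|V_j|^2\le\overline v_j$ and $\underline s_j\le\sum_{k:(j,k)\in E}y_{jk}^HV_j(V_j^H-V_k^H)\le\overline s_j$. Partial matrices: for an undirected graph $F$ on $N^+$, a partial matrix $W_F$ is a collection of complex numbers $[W_F]_{jj}$ (nodes) and $[W_F]_{jk},[W_F]_{kj}$ (edges of $F$). The submatrix on $F$ of a (partial) matrix is the collection of its entries on nodes and edges of $F$; $W_F(q)$ is the principal submatrix on a clique $q$ of $F$ (for an edge, the $2\times2$ matrix $W_F(j,k)$). $W_F\succeq0$ means $W_F$ is Hermitian and $W_F(q)\succeq0$ for all cliques $q$ of $F$. A graph is chordal if all its chordless cycles have length three (or it has no cycle); a chordal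 extension $c(G)$ of $G$ is a chordal graph on the same nodes containing all edges of $G$. Operational constraints (OC) on a (partial) matrix with submatrix $W_G$ on $G$: for all $j\in N^+$, $\underline s_j\le\sum_{k:(j,k)\in E}y_{jk}^H([W_G]_{jj}-[W_G]_{jk})\le\overline s_j$ and $\underline v_j\le[W_G]_{jj}\le\overline v_j$. Sets: $\mathbb W^+$ is the set of Hermitian $(n+1)\times(n+1)$ matrices $W$ with $W\succeq0$ whose submatrix $W_G$ satisfies (OC). $\mathbb W_{c(G)}^+$ is the set of partial matrices $W_{c(G)}$ on $c(G)$ with $W_{c(G)}\succeq0$ whose submatrix $W_G$ satisfies (OC). $\mathbb W_G^+$ is the set of Hermitian partial matrices $W_G$ on $G$ satisfying (OC) and $W_G(j,k)\succeq0$ for all $(j,k)\in E$. Cost: $C$ is a given real-valued cost function of the partial matrix $W_G$ on $G$. The cost of $V\in\mathbb V$ is $C(W_G(V))$ with $[W_G(V)]_{jj}=|V_j|^2$, $[W_G(V)]_{jk}=V_jV_k^H$ for $(j,k)\in E$; the cost of a matrix $W$ or a partial matrix $W_{c(G)}$ is $C$ of its submatrix on $G$. $A\sqsubseteq B$ ($A$ is an effective subset of $B$) means: for every $a\in A$ there is $b\in B$ with the same cost, $C(a)=C(b)$. $A\simeq B$ means $A\sqsubseteq B$ and $B\sqsubseteq A$. *)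

theory Defs
  imports
    "HOL-Library.Extended_Real"
    "HOL-Library.FuncSet"
    "Jordan_Normal_Form.Matrix"
begin

text \<open>An undirected simple graph is given by its set of ordered adjacent pairs.\<close>

definition simple_graph :: "nat \<Rightarrow> (nat \<times> nat) set \<Rightarrow> bool" where
  "simple_graph n F \<longleftrightarrow> F \<subseteq> {0..n} \<times> {0..n} \<and> sym F \<and> irrefl F"

definition connected_graph :: "nat \<Rightarrow> (nat \<times> nat) set \<Rightarrow> bool" where
  "connected_graph n F \<longleftrightarrow> (\<forall>j\<in>{0..n}. \<forall>k\<in>{0..n}. (j, k) \<in> F\<^sup>*)"

text \<open>Cycles are listed without repeating the first vertex; the length of the list is the
  length of the cycle.\<close>

definition graph_cycle :: "(nat \<times> nat) set \<Rightarrow> nat list \<Rightarrow> bool" where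
  "graph_cycle F c \<longleftrightarrow> length c \<ge> 3 \<and> distinct c \<and>
     (\<forall>i<length c. (c ! i, c ! (Suc i mod length c)) \<in> F)"

definition chordless :: "(nat \<times> nat) set \<Rightarrow> nat list \<Rightarrow> bool" where
  "chordless F c \<longleftrightarrow> (\<forall>i<length c. \<forall>j<length c. (c ! i, c ! j) \<in> F \<longrightarrow>
     j = Suc i mod length c \<or> i = Suc j mod length c)"

definition chordal :: "(nat \<times> nat) set \<Rightarrow> bool" where
  "chordal F \<longleftrightarrow> (\<forall>c. graph_cycle F c \<and> chordless F c \<longrightarrow> length c = 3)"

definition chordal_extension :: "nat \<Rightarrow> (nat \<times> nat) set \<Rightarrow> (nat \<times> nat) set \<Rightarrow> bool" where
  "chordal_extension n E F \<longleftrightarrow> simple_graph n F \<and> E \<subseteq> F \<and> chordal F"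

definition tree_graph :: "nat \<Rightarrow> (nat \<times> nat) set \<Rightarrow> bool" where
  "tree_graph n F \<longleftrightarrow> simple_graph n F \<and> connected_graph n F \<and> (\<nexists>c. graph_cycle F c)"

definition clique :: "nat \<Rightarrow> (nat \<times> nat) set \<Rightarrow> nat set \<Rightarrow> bool" where
  "clique n F q \<longleftrightarrow> q \<subseteq> {0..n} \<and> (\<forall>j\<in>q. \<forall>k\<in>q. j \<noteq> k \<longrightarrow> (j, k) \<in> F)"

text \<open>A partial matrix on a graph is a function on the positions of that graph, extended by
  \<^term>\<open>undefined\<close> elsewhere, so that two partial matrices are equal iff their entries
  on nodes and edges agree.\<close>

type_synonym partial_matrix = "nat \<times> nat \<Rightarrow> complex"

definition positions :: "nat \<Rightarrow> (nat \<times> nat) set \<Rightarrow> (nat \<times> nat) set" where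
  "positions n F = {(j, j) | j. j \<in> {0..n}} \<union> F"

definition partial_matrices :: "nat \<Rightarrow> (nat \<times> nat) set \<Rightarrow> partial_matrix set" where
  "partial_matrices n F = extensional (positions n F)"

definition submatrix_on :: "nat \<Rightarrow> (nat \<times> nat) set \<Rightarrow> (nat \<times> nat \<Rightarrow> complex) \<Rightarrow> partial_matrix" where
  "submatrix_on n F W = restrict W (positions n F)"

definition hermitian_on :: "(nat \<times> nat) set \<Rightarrow> (nat \<times> nat \<Rightarrow> complex) \<Rightarrow> bool" where
  "hermitian_on P W \<longleftrightarrow> (\<forall>(j, k)\<in>P. W (k, j) = cnj (W (j, k)))"

text \<open>Positive semidefiniteness of the principal submatrix with rows and columns \<open>q\<close>. The
  quadratic form is real because that submatrix is Hermitian.\<close>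

definition psd_on :: "nat set \<Rightarrow> (nat \<times> nat \<Rightarrow> complex) \<Rightarrow> bool" where
  "psd_on q W \<longleftrightarrow> hermitian_on (q \<times> q) W \<and>
     (\<forall>x :: nat \<Rightarrow> complex. 0 \<le> Re (\<Sum>j\<in>q. \<Sum>k\<in>q. cnj (x j) * W (j, k) * x k))"

definition partial_psd :: "nat \<Rightarrow> (nat \<times> nat) set \<Rightarrow> partial_matrix \<Rightarrow> bool" where
  "partial_psd n F W \<longleftrightarrow> hermitian_on (positions n F) W \<and> (\<forall>q. clique n F q \<longrightarrow> psd_on q W)"

text \<open>Power bounds are extended complex numbers, represented by their real and imaginary
  parts.\<close>

record network =
  last_bus :: nat
  edges :: "(nat \<times> nat) set"
  admittance :: "nat \<Rightarrow> nat \<Rightarrow> complex"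
  v_min :: "nat \<Rightarrow> real"
  v_max :: "nat \<Rightarrow> real"
  s_min :: "nat \<Rightarrow> ereal \<times> ereal"
  s_max :: "nat \<Rightarrow> ereal \<times> ereal"

definition valid_network :: "network \<Rightarrow> bool" where
  "valid_network N \<longleftrightarrow>
     simple_graph (last_bus N) (edges N) \<and> connected_graph (last_bus N) (edges N) \<and>
     (\<forall>(j, k)\<in>edges N. admittance N j k = admittance N k j \<and> admittance N j k \<noteq> 0) \<and>
     (\<forall>j\<in>{0..last_bus N}. 0 < v_min N j \<and> v_min N j \<le> v_max N j) \<and>
     v_min N 0 = 1 \<and> v_max N 0 = 1 \<and>
     s_min N 0 = (-\<infinity>, -\<infinity>) \<and> s_max N 0 = (\<infinity>, \<infinity>)"

text \<open>\<open>a \<le> z \<le> b\<close>, where \<open>\<le>\<close> compares both the real and the imaginary parts. This is not the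
  library order on \<^typ>\<open>complex\<close>, which requires equal imaginary parts.\<close>

definition between :: "ereal \<times> ereal \<Rightarrow> complex \<Rightarrow> ereal \<times> ereal \<Rightarrow> bool" where
  "between a z b \<longleftrightarrow> fst a \<le> ereal (Re z) \<and> snd a \<le> ereal (Im z) \<and>
     ereal (Re z) \<le> fst b \<and> ereal (Im z) \<le> snd b"

definition voltages :: "network \<Rightarrow> complex vec set" where
  "voltages N = {V \<in> carrier_vec (last_bus N + 1). V $ 0 = 1 \<and>
     (\<forall>j\<in>{0..last_bus N}.
        v_min N j \<le> (cmod (V $ j))\<^sup>2 \<and> (cmod (V $ j))\<^sup>2 \<le> v_max N j \<and>
        between (s_min N j)
          (\<Sum>k | (j, k) \<in> edges N. cnj (admittance N j k) * (V $ j) * (cnj (V $ j) - cnj (V $ k)))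
          (s_max N j))}"

definition operational :: "network \<Rightarrow> partial_matrix \<Rightarrow> bool" where
  "operational N W \<longleftrightarrow> (\<forall>j\<in>{0..last_bus N}.
     between (s_min N j)
       (\<Sum>k | (j, k) \<in> edges N. cnj (admittance N j k) * (W (j, j) - W (j, k)))
       (s_max N j) \<and>
     between (ereal (v_min N j), 0) (W (j, j)) (ereal (v_max N j), 0))"

abbreviation network_submatrix :: "network \<Rightarrow> (nat \<times> nat \<Rightarrow> complex) \<Rightarrow> partial_matrix" where
  "network_submatrix N \<equiv> submatrix_on (last_bus N) (edges N)"

definition W_full :: "network \<Rightarrow> complex mat set" where
  "W_full N = {W \<in> carrier_mat (last_bus N + 1) (last_bus N + 1).
     psd_on {0..last_bus N} (($$) W) \<and> operational N (network_submatrix N (($$) W))}"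

definition W_chordal :: "network \<Rightarrow> (nat \<times> nat) set \<Rightarrow> partial_matrix set" where
  "W_chordal N F = {W \<in> partial_matrices (last_bus N) F.
     partial_psd (last_bus N) F W \<and> operational N (network_submatrix N W)}"

definition W_edge :: "network \<Rightarrow> partial_matrix set" where
  "W_edge N = {W \<in> partial_matrices (last_bus N) (edges N).
     hermitian_on (positions (last_bus N) (edges N)) W \<and> operational N W \<and>
     (\<forall>(j, k)\<in>edges N. psd_on {j, k} W)}"

definition cost_voltage :: "network \<Rightarrow> (partial_matrix \<Rightarrow> real) \<Rightarrow> complex vec \<Rightarrow> real" where
  "cost_voltage N C V = C (network_submatrix N
     (\<lambda>(j, k). if j = k then of_real ((cmod (V $ j))\<^sup>2) else V $ j * cnj (V $ k)))"

definition cost_full :: "network \<Rightarrow> (partial_matrix \<Rightarrow> real) \<Rightarrow> complex mat \<Rightarrow> real" where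
  "cost_full N C W = C (network_submatrix N (($$) W))"

definition cost_partial :: "network \<Rightarrow> (partial_matrix \<Rightarrow> real) \<Rightarrow> partial_matrix \<Rightarrow> real" where
  "cost_partial N C W = C (network_submatrix N W)"

text \<open>Each set comes with its own cost function, since the sets have elements of different
  types.\<close>

definition effective_subset ::
  "'a set \<Rightarrow> ('a \<Rightarrow> real) \<Rightarrow> 'b set \<Rightarrow> ('b \<Rightarrow> real) \<Rightarrow> bool" where
  "effective_subset A cA B cB \<longleftrightarrow> (\<forall>a\<in>A. \<exists>b\<in>B. cA a = cB b)"

definition effective_equal ::
  "'a set \<Rightarrow> ('a \<Rightarrow> real) \<Rightarrow> 'b set \<Rightarrow> ('b \<Rightarrow> real) \<Rightarrow> bool" where
  "effective_equal A cA B cB \<longleftrightarrow> effective_subset A cA B cB \<and> effective_subset B cB A cA"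

end

theory Submission
  imports Defs
begin

text \<open>The substantial inclusion is that every partial matrix on a chordal graph whose clique
  submatrices are positive semidefinite has a positive semidefinite completion. If two vertices are
  nonadjacent, a clique separates them; the two sides together with the separator are completed
  recursively and the completions are glued along the separator. Costs only depend on the entries
  on \<open>G\<close>, which completion preserves. A tree is chordal and its cliques have at most two
  vertices, so that it is its own chordal extension and its edge constraints are the clique
  constraints.\<close>

section \<open>Positive semidefinite matrices indexed by finite sets\<close>

lemma psd_onI:
  assumes "\<And>j k. j \<in> q \<Longrightarrow> k \<in> q \<Longrightarrow> W (k, j) = cnj (W (j, k))"
    and "\<And>x. 0 \<le> Re (\<Sum>j\<in>q. \<Sum>k\<in>q. cnj (x j) * W (j, k) * x k)"
  shows "psd_on q W"
  unfolding psd_on_def hermitian_on_def using assms by blast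

lemma psd_on_hermitian:
  "psd_on q W \<Longrightarrow> j \<in> q \<Longrightarrow> k \<in> q \<Longrightarrow> W (k, j) = cnj (W (j, k))"
  unfolding psd_on_def hermitian_on_def by blast

lemma psd_on_cnj:
  "psd_on q W \<Longrightarrow> j \<in> q \<Longrightarrow> k \<in> q \<Longrightarrow> cnj (W (j, k)) = W (k, j)"
  by (rule psd_on_hermitian[symmetric])

lemma psd_on_nonneg:
  "psd_on q W \<Longrightarrow> 0 \<le> Re (\<Sum>j\<in>q. \<Sum>k\<in>q. cnj (x j) * W (j, k) * x k)"
  by (auto simp: psd_on_def)

lemma psd_on_cong:
  assumes "\<And>j k. j \<in> q \<Longrightarrow> k \<in> q \<Longrightarrow> W (j, k) = W' (j, k)"
  shows "psd_on q W \<longleftrightarrow> psd_on q W'"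
  by (simp add: psd_on_def hermitian_on_def assms)

text \<open>The form of \<open>P\<^sup>H M P\<close> at \<open>x\<close> is the form of
  \<open>M\<close> at \<open>P x\<close>; expanding and interchanging the four sums shows this.
  \<open>P\<close> is rectangular, with rows in \<open>T\<close> and columns in \<open>U\<close>.
  Both Schur complements and glued matrices are obtained as such congruences.\<close>

lemma psd_on_congruence:
  assumes psd: "psd_on T M" and "finite T" "finite U"
  shows "psd_on U (\<lambda>(j, k). \<Sum>l\<in>T. \<Sum>m\<in>T. cnj (P l j) * M (l, m) * P m k)"
proof (rule psd_onI)
  fix j k assume "j \<in> U" "k \<in> U"
  have "cnj (\<Sum>l\<in>T. \<Sum>m\<in>T. cnj (P l j) * M (l, m) * P m k) =
     (\<Sum>l\<in>T. \<Sum>m\<in>T. P l j * M (m, l) * cnj (P m k))"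
    by (simp add: psd_on_cnj[OF psd])
  also have "\<dots> = (\<Sum>m\<in>T. \<Sum>l\<in>T. cnj (P m k) * M (m, l) * P l j)"
    by (subst sum.swap) (simp add: mult_ac)
  finally show "(case (k, j) of (j, k) \<Rightarrow> \<Sum>l\<in>T. \<Sum>m\<in>T. cnj (P l j) * M (l, m) * P m k) =
    cnj (case (j, k) of (j, k) \<Rightarrow> \<Sum>l\<in>T. \<Sum>m\<in>T. cnj (P l j) * M (l, m) * P m k)"
    by simp
next
  fix x :: "nat \<Rightarrow> complex"
  define y where "y l = (\<Sum>k\<in>U. P l k * x k)" for l
  have "(\<Sum>l\<in>T. \<Sum>m\<in>T. cnj (y l) * M (l, m) * y m) =
    (\<Sum>l\<in>T. \<Sum>m\<in>T. \<Sum>j\<in>U. \<Sum>k\<in>U. cnj (x j) * (cnj (P l j) * M (l, m) * P m k) * x k)"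
    unfolding y_def cnj_sum by (simp add: sum_distrib_left sum_distrib_right mult_ac)
  also have "\<dots> = (\<Sum>l\<in>T. \<Sum>j\<in>U. \<Sum>m\<in>T. \<Sum>k\<in>U. cnj (x j) * (cnj (P l j) * M (l, m) * P m k) * x k)"
    by (rule sum.cong[OF refl]) (rule sum.swap)
  also have "\<dots> = (\<Sum>l\<in>T. \<Sum>j\<in>U. \<Sum>k\<in>U. \<Sum>m\<in>T. cnj (x j) * (cnj (P l j) * M (l, m) * P m k) * x k)"
    by (rule sum.cong[OF refl], rule sum.cong[OF refl]) (rule sum.swap)
  also have "\<dots> = (\<Sum>j\<in>U. \<Sum>l\<in>T. \<Sum>k\<in>U. \<Sum>m\<in>T. cnj (x j) * (cnj (P l j) * M (l, m) * P m k) * x k)"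
    by (rule sum.swap)
  also have "\<dots> = (\<Sum>j\<in>U. \<Sum>k\<in>U. \<Sum>l\<in>T. \<Sum>m\<in>T. cnj (x j) * (cnj (P l j) * M (l, m) * P m k) * x k)"
    by (rule sum.cong[OF refl]) (rule sum.swap)
  also have "\<dots> = (\<Sum>j\<in>U. \<Sum>k\<in>U. cnj (x j) * (\<Sum>l\<in>T. \<Sum>m\<in>T. cnj (P l j) * M (l, m) * P m k) * x k)"
    by (simp add: sum_distrib_left sum_distrib_right)
  finally show "0 \<le> Re (\<Sum>j\<in>U. \<Sum>k\<in>U. cnj (x j) *
      (case (j, k) of (j, k) \<Rightarrow> \<Sum>l\<in>T. \<Sum>m\<in>T. cnj (P l j) * M (l, m) * P m k) * x k)"
    using psd_on_nonneg[OF psd, of y] by simp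
qed

lemma psd_on_add:
  assumes "psd_on U M" "psd_on U M'"
  shows "psd_on U (\<lambda>p. M p + M' p)"
proof (rule psd_onI)
  fix j k assume "j \<in> U" "k \<in> U"
  then show "M (k, j) + M' (k, j) = cnj (M (j, k) + M' (j, k))"
    using assms by (simp add: psd_on_cnj)
next
  fix x
  show "0 \<le> Re (\<Sum>j\<in>U. \<Sum>k\<in>U. cnj (x j) * (M (j, k) + M' (j, k)) * x k)"
    using psd_on_nonneg[OF assms(1), of x] psd_on_nonneg[OF assms(2), of x]
    by (simp add: ring_distribs sum.distrib)
qed

text \<open>The form factors as \<open>z * cnj z\<close>, where \<open>z\<close> is the inner
  product of \<open>x\<close> and \<open>v\<close>.\<close>

lemma psd_on_rank_one: "psd_on q (\<lambda>(j, k). v j * cnj (v k))"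
proof (rule psd_onI)
  fix x :: "nat \<Rightarrow> complex"
  have "(\<Sum>j\<in>q. \<Sum>k\<in>q. cnj (x j) * (v j * cnj (v k)) * x k) =
    (\<Sum>j\<in>q. cnj (x j) * v j) * cnj (\<Sum>k\<in>q. cnj (x k) * v k)"
    by (simp add: sum_product mult_ac)
  then show "0 \<le> Re (\<Sum>j\<in>q. \<Sum>k\<in>q. cnj (x j) * (case (j, k) of (j, k) \<Rightarrow> v j * cnj (v k)) * x k)"
    by (simp add: complex_mult_cnj del: cnj_sum)
qed simp

text \<open>A vector on \<open>U\<close> extends by zero to \<open>T\<close> without changing the
  value of the form.\<close>

lemma psd_on_subset:
  assumes psd: "psd_on T M" and "U \<subseteq> T" "finite T"
  shows "psd_on U M"
proof -
  have "0 \<le> Re (\<Sum>j\<in>U. \<Sum>k\<in>U. cnj (x j) * M (j, k) * x k)" for x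
  proof -
    define y where "y j = (if j \<in> U then x j else 0)" for j
    have "(\<Sum>j\<in>T. \<Sum>k\<in>T. cnj (y j) * M (j, k) * y k) =
      (\<Sum>j\<in>U. \<Sum>k\<in>T. cnj (y j) * M (j, k) * y k)"
      using assms by (intro sum.mono_neutral_right) (auto simp: y_def)
    also have "\<dots> = (\<Sum>j\<in>U. \<Sum>k\<in>U. cnj (x j) * M (j, k) * x k)"
      using assms by (intro sum.cong[OF refl] sum.mono_neutral_cong_right) (auto simp: y_def)
    finally show ?thesis using psd_on_nonneg[OF psd, of y] by simp
  qed
  then show ?thesis
    using assms by (auto intro!: psd_onI psd_on_hermitian[OF psd])
qed

section \<open>Ranges of principal submatrices and gluing along a common block\<close>

lemma psd_on_zero_diagonal:
  assumes psd: "psd_on T M" and "finite T" "p \<in> T" "k \<in> T" "M (p, p) = 0"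
  shows "M (p, k) = 0"
proof (cases "p = k")
  case True
  then show ?thesis using \<open>M (p, p) = 0\<close> by simp
next
  case False
  have psd2: "psd_on {p, k} M"
    using assms by (intro psd_on_subset[OF psd]) auto
  have kp: "M (k, p) = cnj (M (p, k))"
    by (rule psd_on_hermitian[OF psd2]) auto
  \<comment> \<open>The test vector is \<open>- c * M (p, k)\<close> at \<open>p\<close> and
    \<open>1\<close> at \<open>k\<close>. As \<open>M (p, p) = 0\<close>, the form is affine in the
    real parameter \<open>c\<close>.\<close>
  have *: "0 \<le> Re (M (k, k)) - 2 * c * (cmod (M (p, k)))\<^sup>2" for c :: real
    using psd_on_nonneg[OF psd2, of "\<lambda>i. if i = p then - of_real c * M (p, k) else 1"]
      False \<open>M (p, p) = 0\<close>
    by (simp add: kp cmod_power2) (simp add: power2_eq_square algebra_simps)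
  show ?thesis
  proof (rule ccontr)
    assume "M (p, k) \<noteq> 0"
    then show False
      \<comment> \<open>For this \<open>c\<close> the right-hand side of the inequality is
        \<open>-1\<close>.\<close>
      using *[of "(Re (M (k, k)) + 1) / (2 * (cmod (M (p, k)))\<^sup>2)"] by (simp add: field_simps)
  qed
qed

text \<open>A column of a positive semidefinite matrix lies in the range of the principal submatrix
  obtained by deleting its index; the induction eliminates one row at a time by passing to Schur
  complements.\<close>

lemma psd_on_column_in_range:
  assumes "finite K" "v \<notin> K" "psd_on (insert v K) M"
  shows "\<exists>x. \<forall>j\<in>K. (\<Sum>k\<in>K. M (j, k) * x k) = M (j, v)"
  using assms
proof (induction K arbitrary: M rule: finite_induct)
  case empty
  then show ?case by simp
next
  case (insert p K)
  note psd = insert.prems(2)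
  have v: "v \<notin> K" "v \<noteq> p" using insert.prems by auto
  show ?case
  proof (cases "M (p, p) = 0")
    case True
    \<comment> \<open>With a zero pivot the whole row \<open>p\<close> vanishes, and by symmetry of
      the argument nothing else has to be corrected: a solution for \<open>K\<close>, extended by
      \<open>0\<close> at \<open>p\<close>, solves the rows in \<open>K\<close> and also row
      \<open>p\<close>, which reads \<open>0 = 0\<close>.\<close>
    have zero: "M (p, k) = 0" if "k \<in> insert v (insert p K)" for k
      using psd_on_zero_diagonal[OF psd] that True insert.hyps by blast
    have "psd_on (insert v K) M"
      using insert.hyps by (intro psd_on_subset[OF psd]) auto
    with insert.IH v obtain x where x: "\<And>j. j \<in> K \<Longrightarrow> (\<Sum>k\<in>K. M (j, k) * x k) = M (j, v)"
      by blast
    have "(\<Sum>k\<in>insert p K. M (j, k) * (x(p := 0)) k) = M (j, v)" if "j \<in> insert p K" for j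
    proof -
      have "(\<Sum>k\<in>insert p K. M (j, k) * (x(p := 0)) k) = (\<Sum>k\<in>K. M (j, k) * x k)"
        using insert.hyps by (auto intro!: sum.cong)
      then show ?thesis
        using that x zero by auto
    qed
    then show ?thesis by blast
  next
    case False
    \<comment> \<open>\<open>M'\<close> is the Schur complement of the pivot
      \<open>M (p, p)\<close>. Column \<open>j\<close> of \<open>P\<close> is the unit vector of
      \<open>j\<close> minus \<open>M (p, j) / M (p, p)\<close> times the unit vector of
      \<open>p\<close>, so that \<open>P\<^sup>H M P = M'\<close> and positive semidefiniteness is
      inherited.\<close>
    define M' where "M' = (\<lambda>(j, k). M (j, k) - M (j, p) * M (p, k) / M (p, p))"
    define P where "P l j = (if l = p then - M (p, j) / M (p, p) else of_bool (l = j))" for l j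
    let ?T = "insert p (insert v K)"
    have psd': "psd_on ?T M" using psd by (simp add: insert_commute)
    have fin: "finite (insert v K)" "finite ?T" and pn: "p \<notin> insert v K"
      using insert.hyps v by auto
    have "psd_on (insert v K) M'"
    proof -
      have "(\<Sum>l\<in>?T. \<Sum>m\<in>?T. cnj (P l j) * M (l, m) * P m k) = M' (j, k)"
        if jk: "j \<in> insert v K" "k \<in> insert v K" for j k
      proof -
        have inner: "(\<Sum>m\<in>?T. M (l, m) * P m k) = M (l, k) - M (l, p) * M (p, k) / M (p, p)"
          for l
        proof -
          have "(\<Sum>m\<in>?T. M (l, m) * P m k) = M (l, p) * P p k + (\<Sum>m\<in>insert v K. M (l, m) * P m k)"
            using fin pn by (subst sum.insert) auto
          also have "(\<Sum>m\<in>insert v K. M (l, m) * P m k) = (\<Sum>m\<in>insert v K. if m = k then M (l, k) else 0)"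
            using pn by (intro sum.cong) (auto simp: P_def)
          finally show ?thesis using fin jk by (simp add: P_def)
        qed
        have "(\<Sum>l\<in>?T. \<Sum>m\<in>?T. cnj (P l j) * M (l, m) * P m k) =
           (\<Sum>l\<in>?T. cnj (P l j) * (M (l, k) - M (l, p) * M (p, k) / M (p, p)))"
          by (simp only: mult.assoc sum_distrib_left[symmetric] inner)
        \<comment> \<open>The summand at \<open>l = p\<close> vanishes: \<open>P\<close> is built to
          annihilate row \<open>p\<close> of \<open>M P\<close>.\<close>
        also have "\<dots> = (\<Sum>l\<in>insert v K. cnj (P l j) * (M (l, k) - M (l, p) * M (p, k) / M (p, p)))"
          using fin pn False by (subst sum.insert) auto
        also have "\<dots> = (\<Sum>l\<in>insert v K. if l = j then M' (j, k) else 0)"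
          using pn by (intro sum.cong) (auto simp: P_def M'_def)
        finally show ?thesis using fin jk by simp
      qed
      then show ?thesis
        using psd_on_congruence[OF psd' fin(2,1), of P] by (subst (asm) psd_on_cong[where W' = M']) auto
    qed
    with insert.IH v obtain x where x: "\<And>j. j \<in> K \<Longrightarrow> (\<Sum>k\<in>K. M' (j, k) * x k) = M' (j, v)"
      by blast
    \<comment> \<open>Back substitution: \<open>t\<close> is the value at \<open>p\<close> that
      solves the equation of row \<open>p\<close>. Inserting it into a row \<open>j\<close> in
      \<open>K\<close> turns the reduced equation for \<open>M'\<close> into the one for
      \<open>M\<close>.\<close>
    define t where "t = (M (p, v) - (\<Sum>k\<in>K. M (p, k) * x k)) / M (p, p)"
    have split: "(\<Sum>k\<in>insert p K. M (j, k) * (x(p := t)) k) = M (j, p) * t + (\<Sum>k\<in>K. M (j, k) * x k)" for j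
    proof -
      have "(\<Sum>k\<in>K. M (j, k) * (x(p := t)) k) = (\<Sum>k\<in>K. M (j, k) * x k)"
        using insert.hyps by (intro sum.cong) auto
      then show ?thesis using insert.hyps by simp
    qed
    have "(\<Sum>k\<in>insert p K. M (j, k) * (x(p := t)) k) = M (j, v)" if "j \<in> insert p K" for j
    proof (cases "j = p")
      case True
      then show ?thesis unfolding split using False by (simp add: t_def)
    next
      case jp: False
      then have "(\<Sum>k\<in>K. M' (j, k) * x k) = M' (j, v)" using x that by simp
      moreover have "(\<Sum>k\<in>K. M' (j, k) * x k) =
          (\<Sum>k\<in>K. M (j, k) * x k) - M (j, p) / M (p, p) * (\<Sum>k\<in>K. M (p, k) * x k)"
        by (simp add: M'_def sum_distrib_left algebra_simps sum_subtractf)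
      ultimately have "(\<Sum>k\<in>K. M (j, k) * x k) =
          M' (j, v) + M (j, p) / M (p, p) * (\<Sum>k\<in>K. M (p, k) * x k)"
        by (simp add: diff_eq_eq)
      then show ?thesis
        unfolding split by (simp add: t_def M'_def right_diff_distrib diff_divide_distrib)
    qed
    then show ?thesis by blast
  qed
qed

text \<open>Only the block between \<open>A\<close> and \<open>B\<close> is free. If
  \<open>X\<close> expresses the columns \<open>M' (_, v)\<close>, \<open>v\<close> in
  \<open>B\<close>, through the columns of the common block on \<open>S\<close>, then
  \<open>M\<^sub>A\<^sub>S X\<close> is a valid choice for it. Such an \<open>X\<close> exists even
  for a singular block on \<open>S\<close>, by the range property of columns.\<close>

lemma psd_on_glue:
  assumes M: "psd_on (A \<union> S) M" and M': "psd_on (S \<union> B) M'"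
    and fin: "finite A" "finite S" "finite B"
    and disj: "A \<inter> S = {}" "A \<inter> B = {}" "S \<inter> B = {}"
    and agree: "\<And>j k. j \<in> S \<Longrightarrow> k \<in> S \<Longrightarrow> M (j, k) = M' (j, k)"
  obtains W where "psd_on (A \<union> S \<union> B) W"
    and "\<And>j k. j \<in> A \<union> S \<Longrightarrow> k \<in> A \<union> S \<Longrightarrow> W (j, k) = M (j, k)"
    and "\<And>j k. j \<in> S \<union> B \<Longrightarrow> k \<in> S \<union> B \<Longrightarrow> W (j, k) = M' (j, k)"
proof -
  \<comment> \<open>The vertex \<open>v\<close> of \<open>B\<close> is the column index:
    \<open>X v\<close> is column \<open>v\<close> of the matrix \<open>X\<close>, with rows in
    \<open>S\<close>.\<close>
  have "\<exists>x. \<forall>j\<in>S. (\<Sum>k\<in>S. M' (j, k) * x k) = M' (j, v)" if "v \<in> B" for v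
    using that disj fin by (intro psd_on_column_in_range psd_on_subset[OF M']) auto
  then obtain X where X: "\<And>v j. v \<in> B \<Longrightarrow> j \<in> S \<Longrightarrow> (\<Sum>k\<in>S. M' (j, k) * X v k) = M' (j, v)"
    by metis
  text \<open>With \<open>X\<close> solving \<open>M\<^sub>S X = M'\<^bsub>S,B\<^esub>\<close> and \<open>z\<close>, \<open>t\<close> the parts of a vector on \<open>A \<union> S\<close> and \<open>B\<close>,
    the glued form is \<open>(z + X t)\<^sup>H M (z + X t) + (t - X t)\<^sup>H M' (t - X t)\<close>.\<close>
  define P where "P l k = (if k \<in> B then (if l \<in> S then X k l else 0) else of_bool (l = k))" for l k
  define Q where "Q l k = (if k \<in> B then (if l \<in> S then - X k l else of_bool (l = k)) else 0)" for l k
  define W1 where "W1 = (\<lambda>(j, k). \<Sum>l\<in>A \<union> S. \<Sum>m\<in>A \<union> S. cnj (P l j) * M (l, m) * P m k)"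
  define W2 where "W2 = (\<lambda>(j, k). \<Sum>l\<in>S \<union> B. \<Sum>m\<in>S \<union> B. cnj (Q l j) * M' (l, m) * Q m k)"
  define W where "W p = W1 p + W2 p" for p
  have psd: "psd_on (A \<union> S \<union> B) W"
    unfolding W_def W1_def W2_def
    using fin by (intro psd_on_add psd_on_congruence M M') auto
  have MP: "(\<Sum>m\<in>A \<union> S. M (l, m) * P m k) = (if k \<in> B then (\<Sum>m\<in>S. M (l, m) * X k m) else M (l, k))"
    if "k \<in> A \<union> S \<union> B" for l k
  proof (cases "k \<in> B")
    case True
    have "(\<Sum>m\<in>A \<union> S. M (l, m) * P m k) = (\<Sum>m\<in>S. M (l, m) * P m k)"
      using fin disj True by (intro sum.mono_neutral_right) (auto simp: P_def)
    then show ?thesis using True by (simp add: P_def)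
  next
    case False
    then have "(\<Sum>m\<in>A \<union> S. M (l, m) * P m k) = (\<Sum>m\<in>A \<union> S. if m = k then M (l, k) else 0)"
      by (intro sum.cong) (auto simp: P_def)
    then show ?thesis using that False fin by auto
  qed
  have PM: "W1 (j, k) = (if j \<in> B then (\<Sum>l\<in>S. cnj (X j l) * (\<Sum>m\<in>A \<union> S. M (l, m) * P m k))
      else (\<Sum>m\<in>A \<union> S. M (j, m) * P m k))"
    if "j \<in> A \<union> S \<union> B" for j k
  proof -
    have eq: "W1 (j, k) = (\<Sum>l\<in>A \<union> S. cnj (P l j) * (\<Sum>m\<in>A \<union> S. M (l, m) * P m k))"
      by (simp add: W1_def mult.assoc sum_distrib_left)
    show ?thesis
    proof (cases "j \<in> B")
      case True
      have "W1 (j, k) = (\<Sum>l\<in>S. cnj (P l j) * (\<Sum>m\<in>A \<union> S. M (l, m) * P m k))"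
        unfolding eq using fin disj True by (intro sum.mono_neutral_right) (auto simp: P_def)
      then show ?thesis using True by (simp add: P_def)
    next
      case False
      then have "W1 (j, k) = (\<Sum>l\<in>A \<union> S. if l = j then (\<Sum>m\<in>A \<union> S. M (j, m) * P m k) else 0)"
        unfolding eq by (intro sum.cong) (auto simp: P_def)
      then show ?thesis using that False fin by auto
    qed
  qed
  have W2_zero: "W2 (j, k) = 0" if "j \<notin> B \<or> k \<notin> B" for j k
    using that by (auto simp: W2_def Q_def)
  have MQ: "(\<Sum>m\<in>S \<union> B. M' (l, m) * Q m k) = M' (l, k) - (\<Sum>m\<in>S. M' (l, m) * X k m)"
    if "k \<in> B" for l k
  proof -
    have "(\<Sum>m\<in>S \<union> B. M' (l, m) * Q m k) = (\<Sum>m\<in>S. M' (l, m) * Q m k) + (\<Sum>m\<in>B. M' (l, m) * Q m k)"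
      using fin disj by (intro sum.union_disjoint) auto
    also have "(\<Sum>m\<in>S. M' (l, m) * Q m k) = - (\<Sum>m\<in>S. M' (l, m) * X k m)"
      using that by (simp add: Q_def sum_negf)
    also have "(\<Sum>m\<in>B. M' (l, m) * Q m k) = (\<Sum>m\<in>B. if m = k then M' (l, k) else 0)"
      using that disj by (intro sum.cong) (auto simp: Q_def)
    finally show ?thesis using that fin by simp
  qed
  have W2_eq: "W2 (j, k) = M' (j, k) - (\<Sum>m\<in>S. M' (j, m) * X k m)" if "j \<in> B" "k \<in> B" for j k
  proof -
    have "W2 (j, k) = (\<Sum>l\<in>S \<union> B. cnj (Q l j) * (M' (l, k) - (\<Sum>m\<in>S. M' (l, m) * X k m)))"
      using that by (simp add: W2_def mult.assoc sum_distrib_left[symmetric] MQ)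
    \<comment> \<open>For \<open>l\<close> in \<open>S\<close> the bracket is zero by the defining
      equation of \<open>X\<close>.\<close>
    also have "\<dots> = (\<Sum>l\<in>B. cnj (Q l j) * (M' (l, k) - (\<Sum>m\<in>S. M' (l, m) * X k m)))"
      using fin disj that by (intro sum.mono_neutral_right) (auto simp: X)
    also have "\<dots> = (\<Sum>l\<in>B. if l = j then M' (j, k) - (\<Sum>m\<in>S. M' (j, m) * X k m) else 0)"
      using that disj by (intro sum.cong) (auto simp: Q_def)
    finally show ?thesis using that fin by simp
  qed
  have MX: "(\<Sum>m\<in>S. M (j, m) * X k m) = M' (j, k)" if "j \<in> S" "k \<in> B" for j k
    using that X[of k j] by (simp add: agree)
  have W_AS: "W (j, k) = M (j, k)" if "j \<in> A \<union> S" "k \<in> A \<union> S" for j k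
  proof -
    have "j \<notin> B" "k \<notin> B" using that disj by auto
    then show ?thesis using that by (simp add: W_def PM MP W2_zero)
  qed
  have W_SB': "W (j, k) = M' (j, k)" if "j \<in> S" "k \<in> B" for j k
  proof -
    have "j \<notin> B" using that disj by auto
    then show ?thesis using that by (simp add: W_def PM MP W2_zero MX)
  qed
  have W_BB: "W (j, k) = M' (j, k)" if "j \<in> B" "k \<in> B" for j k
  proof -
    \<comment> \<open>Since \<open>M'\<close> is Hermitian, its block on \<open>B\<close> and
      \<open>S\<close> is \<open>X\<^sup>H M'\<^sub>S\<close>. Hence the term subtracted in
      \<open>W2\<close> equals \<open>X\<^sup>H M'\<^sub>S X\<close>, which is exactly what
      \<open>W1\<close> contributes on \<open>B\<close>.\<close>
    have "(\<Sum>m\<in>S. M' (j, m) * X k m) = (\<Sum>m\<in>S. cnj (\<Sum>l\<in>S. M' (m, l) * X j l) * X k m)"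
      using that by (intro sum.cong) (simp_all add: X psd_on_cnj[OF M'] del: cnj_sum)
    also have "\<dots> = (\<Sum>m\<in>S. \<Sum>l\<in>S. M' (l, m) * cnj (X j l) * X k m)"
      by (simp add: sum_distrib_right psd_on_cnj[OF M'])
    also have "\<dots> = (\<Sum>l\<in>S. cnj (X j l) * (\<Sum>m\<in>S. M' (l, m) * X k m))"
      by (subst sum.swap) (simp add: sum_distrib_left mult_ac)
    also have "\<dots> = W1 (j, k)"
      using that by (simp add: PM MP MX X)
    finally show ?thesis using that by (simp add: W_def W2_eq)
  qed
  have W_SB: "W (j, k) = M' (j, k)" if jk: "j \<in> S \<union> B" "k \<in> S \<union> B" for j k
  proof -
    consider "j \<in> S" "k \<in> S" | "j \<in> S" "k \<in> B" | "j \<in> B" "k \<in> S" | "j \<in> B" "k \<in> B"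
      using jk by auto
    then show ?thesis
    proof cases
      case 1 then show ?thesis using W_AS agree by simp
    next
      case 2 then show ?thesis by (rule W_SB')
    next
      case 3
      then show ?thesis
        using W_SB'[of k j] psd_on_hermitian[OF psd, of k j] psd_on_hermitian[OF M', of k j] by simp
    next
      case 4 then show ?thesis by (rule W_BB)
    qed
  qed
  show thesis by (rule that[OF psd W_AS W_SB])
qed

section \<open>Clique separators of chordal graphs\<close>

text \<open>Replacing the stretch from \<open>p i\<close> to \<open>p j\<close> by the edge between
  them gives a path that is shorter by \<open>j - Suc i\<close> and still has its interior in
  \<open>C\<close>; minimality forces this difference to be zero. \<open>L\<close> counts edges, not
  vertices.\<close>

lemma shortest_path_no_shortcut:
  fixes F :: "('a \<times> 'a) set" and C :: "'a set" and s t :: 'a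
  defines "path \<equiv> \<lambda>(L::nat) p. p 0 = s \<and> p L = t \<and> (\<forall>k<L. (p k, p (Suc k)) \<in> F) \<and>
      (\<forall>k. 0 < k \<and> k < L \<longrightarrow> p k \<in> C)"
  assumes p: "path L p" and minimal: "\<And>L' p'. path L' p' \<Longrightarrow> L \<le> L'"
    and ij: "i < j" "j \<le> L" "(p i, p j) \<in> F"
  shows "j = Suc i"
proof -
  define d where "d = j - Suc i"
  define p' where "p' k = (if k \<le> i then p k else p (k + d))" for k
  have "path (L - d) p'"
    unfolding path_def
  proof (intro conjI allI impI)
    show "p' 0 = s" using p by (simp add: p'_def path_def)
    show "p' (L - d) = t"
      using p ij by (auto simp: p'_def path_def d_def)
    fix k assume k: "k < L - d"
    consider "k < i" | "k = i" | "k > i" by linarith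
    then show "(p' k, p' (Suc k)) \<in> F"
    proof cases
      case 2
      then show ?thesis using ij by (simp add: p'_def d_def)
    qed (use p k in \<open>auto simp: p'_def path_def\<close>)
  next
    fix k assume "0 < k \<and> k < L - d"
    then show "p' k \<in> C" using p by (auto simp: p'_def path_def)
  qed
  then have "L \<le> L - d" by (rule minimal)
  then show ?thesis using ij by (simp add: d_def)
qed

text \<open>If \<open>s\<close> and \<open>t\<close> were not adjacent, a shortest path between them
  with interior in \<open>C\<close> would have at least two edges. Closed up through
  \<open>a\<close>, which has no neighbour in \<open>C\<close>, it would be a chordless cycle of
  length at least four.\<close>

lemma chordal_common_neighbours_adjacent:
  fixes F :: "(nat \<times> nat) set" and C :: "nat set"
  assumes F: "sym F" "irrefl F" "chordal F"
    and as: "(a, s) \<in> F" and at: "(a, t) \<in> F" and "s \<noteq> t" "s \<notin> C" "t \<notin> C" "a \<notin> C"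
    and aC: "\<And>c. c \<in> C \<Longrightarrow> (a, c) \<notin> F"
    and path: "p 0 = s" "p L = t" "\<And>k. k < L \<Longrightarrow> (p k, p (Suc k)) \<in> F"
      "\<And>k. 0 < k \<Longrightarrow> k < L \<Longrightarrow> p k \<in> C"
  shows "(s, t) \<in> F"
proof (rule ccontr)
  assume st: "(s, t) \<notin> F"
  define is_path where "is_path L p \<longleftrightarrow> p 0 = s \<and> p L = t \<and> (\<forall>k<L. (p k, p (Suc k)) \<in> F) \<and>
      (\<forall>k. 0 < k \<and> k < L \<longrightarrow> p k \<in> C)" for L :: nat and p
  have "\<exists>L p. is_path L p" using path unfolding is_path_def by blast
  define l where "l = (LEAST L. \<exists>p. is_path L p)"
  have "\<exists>p. is_path l p"
    unfolding l_def using \<open>\<exists>L p. is_path L p\<close> by (rule LeastI_ex)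
  then obtain r where r: "is_path l r" by blast
  have minimal: "l \<le> L'" if "is_path L' p'" for L' p'
    unfolding l_def using that by (blast intro: Least_le)
  have shortcut: "j = Suc i" if "i < j" "j \<le> l" "(r i, r j) \<in> F" for i j
    using shortest_path_no_shortcut[of r s l t F C i j] r minimal that
    unfolding is_path_def by blast
  have r0: "r 0 = s" "r l = t" and rC: "\<And>k. 0 < k \<Longrightarrow> k < l \<Longrightarrow> r k \<in> C"
    and rF: "\<And>k. k < l \<Longrightarrow> (r k, r (Suc k)) \<in> F"
    using r by (auto simp: is_path_def)
  have "l \<noteq> 0" using r0 \<open>s \<noteq> t\<close> by (intro notI) simp
  moreover have "l \<noteq> 1" using r0 rF[of 0] st by (intro notI) simp
  ultimately have l2: "l \<ge> 2" by simp
  have aF: "(a, r k) \<in> F \<longleftrightarrow> k = 0 \<or> k = l" if "k \<le> l" for k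
    using that as at r0 rC[of k] aC[of "r k"] by (cases "k = 0"; cases "k = l") auto
  have a_ne: "a \<noteq> r k" if "k \<le> l" for k
    using that as at r0 rC[of k] \<open>a \<notin> C\<close> \<open>irrefl F\<close> 
    by (cases "k = 0"; cases "k = l") (auto simp: irrefl_def)
  \<comment> \<open>A repetition \<open>r i = r j\<close> with \<open>j < l\<close> makes the edge
    from \<open>r j\<close> to \<open>r (Suc j)\<close> a shortcut from \<open>i\<close> to
    \<open>Suc j\<close>. For \<open>j = l\<close> it contradicts \<open>s \<noteq> t\<close> or
    \<open>t \<notin> C\<close>.\<close>
  have inj: "r i \<noteq> r j" if "i < j" "j \<le> l" for i j
  proof
    assume eq: "r i = r j"
    show False
    proof (cases "j = l")
      case True
      then show False
        using eq that r0 rC[of i] \<open>s \<noteq> t\<close> \<open>t \<notin> C\<close> by (cases "i = 0") auto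
    next
      case False
      then show False
        using eq that rF[of j] shortcut[of i "Suc j"] by simp
    qed
  qed
  \<comment> \<open>The cycle has \<open>l + 2\<close> vertices: index \<open>0\<close> is
    \<open>a\<close> and index \<open>Suc k\<close> is \<open>r k\<close>.\<close>
  define c where "c = a # map r [0..<Suc l]"
  have len: "length c = l + 2" by (simp add: c_def)
  have c0: "c ! 0 = a" by (simp add: c_def)
  have cS: "c ! Suc k = r k" if "k \<le> l" for k
    using that by (simp add: c_def nth_Cons' del: upt_Suc)
  have "inj_on r {0..<Suc l}"
    by (rule linorder_inj_onI) (use inj in auto)
  moreover have "a \<notin> r ` {0..<Suc l}"
  proof
    assume "a \<in> r ` {0..<Suc l}"
    then obtain k where "k < Suc l" "a = r k" by auto
    then show False using a_ne[of k] by simp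
  qed
  ultimately have "distinct c"
    by (simp add: c_def distinct_map del: upt_Suc)
  have idx: "i = 0 \<or> (\<exists>k\<le>l. i = Suc k)" if "i < length c" for i
    using that len by (cases i) auto
  have "graph_cycle F c"
    unfolding graph_cycle_def
  proof (intro conjI allI impI)
    fix i assume "i < length c"
    then consider "i = 0" | k where "k < l" "i = Suc k" | "i = Suc l"
      using idx by (metis le_neq_implies_less)
    then show "(c ! i, c ! (Suc i mod length c)) \<in> F"
    proof cases
      case 1
      then show ?thesis using as c0 cS[of 0] r0 l2 by (simp add: len)
    next
      case 2
      then show ?thesis using rF cS[of k] cS[of "Suc k"] by (simp add: len)
    next
      case 3
      then show ?thesis using at c0 cS[of l] r0 \<open>sym F\<close> by (simp add: len symD)
    qed
  qed (use len l2 \<open>distinct c\<close> in auto)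
  \<comment> \<open>Edges at \<open>a\<close> are controlled by \<open>aF\<close>, edges between
    path vertices by \<open>shortcut\<close>.\<close>
  moreover have "chordless F c"
    unfolding chordless_def
  proof (intro allI impI)
    fix i j assume ij: "i < length c" "j < length c" and e: "(c ! i, c ! j) \<in> F"
    consider "i = 0" "j = 0" | k where "k \<le> l" "i = 0" "j = Suc k" | k where "k \<le> l" "i = Suc k" "j = 0"
      | k m where "k \<le> l" "m \<le> l" "i = Suc k" "j = Suc m"
      using idx[OF ij(1)] idx[OF ij(2)] by blast
    then show "j = Suc i mod length c \<or> i = Suc j mod length c"
    proof cases
      case 1
      then show ?thesis using e \<open>irrefl F\<close> by (simp add: irrefl_def)
    next
      case 2
      then show ?thesis using e c0 cS[of k] aF[of k] l2 by (auto simp: len)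
    next
      case 3
      then have "(a, r k) \<in> F" using e c0 cS[of k] \<open>sym F\<close> by (auto dest: symD)
      then show ?thesis using 3 aF[of k] l2 by (auto simp: len)
    next
      case 4
      then have e': "(r k, r m) \<in> F" "(r m, r k) \<in> F"
        using e cS \<open>sym F\<close> by (auto dest: symD)
      then have "k \<noteq> m" using \<open>irrefl F\<close> by (auto simp: irrefl_def)
      then consider "k < m" | "m < k" by linarith
      then show ?thesis
        by cases (use shortcut[of k m] shortcut[of m k] 4 e' in \<open>auto simp: len\<close>)
    qed
  qed
  ultimately have "length c = 3" using \<open>chordal F\<close> by (simp add: chordal_def)
  then show False using len l2 by simp
qed

text \<open>The separator is the boundary of the component of \<open>b\<close> in the graph without the closed
  neighbourhood of \<open>a\<close>. All its vertices are neighbours of \<open>a\<close>, so two nonadjacent ones would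
  close a chordless cycle through \<open>a\<close>.\<close>

lemma chordal_clique_separator:
  fixes F :: "(nat \<times> nat) set"
  assumes F: "sym F" "irrefl F" "chordal F"
    and ab: "a \<in> U" "b \<in> U" "a \<noteq> b" "(a, b) \<notin> F"
  obtains A S B where "U = A \<union> S \<union> B" "A \<inter> S = {}" "A \<inter> B = {}" "S \<inter> B = {}"
    "a \<in> A" "b \<in> B" "\<And>j k. j \<in> A \<Longrightarrow> k \<in> B \<Longrightarrow> (j, k) \<notin> F"
    "\<And>j k. j \<in> S \<Longrightarrow> k \<in> S \<Longrightarrow> j \<noteq> k \<Longrightarrow> (j, k) \<in> F"
proof -
  \<comment> \<open>\<open>D\<close> is \<open>U\<close> without the closed neighbourhood of
    \<open>a\<close>, \<open>B\<close> the component of \<open>b\<close> in the graph induced on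
    \<open>D\<close>, and \<open>S\<close> the boundary of \<open>B\<close> within
    \<open>U\<close>.\<close>
  define D where "D = {x \<in> U. x \<noteq> a \<and> (a, x) \<notin> F}"
  define R where "R = F \<inter> D \<times> D"
  define B where "B = {x. (b, x) \<in> R\<^sup>*}"
  define S where "S = {x \<in> U - B. \<exists>y\<in>B. (x, y) \<in> F}"
  have "b \<in> D" using ab by (simp add: D_def)
  have "B \<subseteq> D"
  proof
    fix x assume "x \<in> B"
    then have "(b, x) \<in> R\<^sup>*" by (simp add: B_def)
    then show "x \<in> D" using \<open>b \<in> D\<close> by induction (auto simp: R_def)
  qed
  have "sym R" using \<open>sym F\<close> by (auto simp: R_def sym_def)
  \<comment> \<open>Since \<open>a\<close> has no neighbour in \<open>B\<close>, a vertex of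
    \<open>S\<close> differs from \<open>a\<close>. If it were not adjacent to \<open>a\<close>, it
    would lie in \<open>D\<close> and so belong to the component \<open>B\<close> that it
    touches.\<close>
  have SF: "(a, x) \<in> F" if "x \<in> S" for x
  proof (rule ccontr)
    assume "(a, x) \<notin> F"
    from that obtain y where y: "y \<in> B" "(x, y) \<in> F" "x \<in> U" "x \<notin> B" by (auto simp: S_def)
    have "(y, x) \<in> F" using y \<open>sym F\<close> by (auto dest: symD)
    moreover have "x \<noteq> a" using y \<open>B \<subseteq> D\<close> by (auto simp: D_def)
    ultimately have "(y, x) \<in> R"
      using \<open>(a, x) \<notin> F\<close> y \<open>B \<subseteq> D\<close> by (auto simp: R_def D_def)
    then have "x \<in> B" using \<open>y \<in> B\<close> unfolding B_def by (auto intro: rtrancl_into_rtrancl)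
    then show False using y by simp
  qed
  have clique: "(s, t) \<in> F" if st: "s \<in> S" "t \<in> S" "s \<noteq> t" for s t
  proof -
    obtain x y where x: "x \<in> B" "(s, x) \<in> F" and y: "y \<in> B" "(t, y) \<in> F"
      using st by (auto simp: S_def)
    \<comment> \<open>\<open>x\<close> and \<open>y\<close> are connected inside \<open>B\<close> by
      way of \<open>b\<close>.\<close>
    have "(x, b) \<in> R\<^sup>*" using x \<open>sym R\<close> unfolding B_def by (auto intro: symD[OF sym_rtrancl])
    then have "(x, y) \<in> R\<^sup>*" using y unfolding B_def by auto
    then obtain m f where f: "f 0 = x" "f m = y" "\<And>i. i < m \<Longrightarrow> (f i, f (Suc i)) \<in> R"
      by (auto simp: rtrancl_power relpow_fun_conv)
    have fB: "f i \<in> B" if "i \<le> m" for i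
      using that
    proof (induction i)
      case 0
      then show ?case using f x by simp
    next
      case (Suc i)
      then show ?case using f(3)[of i] unfolding B_def by (auto intro: rtrancl_into_rtrancl)
    qed
    \<comment> \<open>The path \<open>f\<close> from \<open>x\<close> to \<open>y\<close> with
      \<open>s\<close> put in front and \<open>t\<close> at the end, hence the shift by one and the
      length \<open>m + 2\<close>.\<close>
    define p where "p k = (if k = 0 then s else if k \<le> Suc m then f (k - 1) else t)" for k
    show ?thesis
    proof (rule chordal_common_neighbours_adjacent[OF F SF[OF st(1)] SF[OF st(2)] st(3), where C = B])
      show "p 0 = s" "p (m + 2) = t" by (auto simp: p_def)
      show "(p k, p (Suc k)) \<in> F" if k: "k < m + 2" for k
      proof -
        consider "k = 0" | i where "k = Suc i" "i < m" | "k = Suc m"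
          using k by (cases k) (force simp: less_Suc_eq)+
        then show ?thesis
          by cases (use f x y \<open>sym F\<close> in \<open>auto simp: p_def R_def dest: symD\<close>)
      qed
      show "p k \<in> B" if "0 < k" "k < m + 2" for k
        using that fB[of "k - 1"] by (auto simp: p_def)
      show "s \<notin> B" "t \<notin> B" using st by (auto simp: S_def)
      show "a \<notin> B" "\<And>c. c \<in> B \<Longrightarrow> (a, c) \<notin> F" using \<open>B \<subseteq> D\<close> by (auto simp: D_def)
    qed
  qed
  show thesis
  proof (rule that)
    \<comment> \<open>The side of \<open>a\<close> is everything that remains. It has no edge to
      \<open>B\<close> because \<open>S\<close> contains every vertex of \<open>U - B\<close> with a
      neighbour in \<open>B\<close>.\<close>
    show "U = (U - S - B) \<union> S \<union> B"
      using \<open>B \<subseteq> D\<close> by (auto simp: S_def D_def)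
    have "a \<notin> S" using SF \<open>irrefl F\<close> by (auto simp: irrefl_def)
    then show "a \<in> U - S - B" using ab \<open>B \<subseteq> D\<close> by (auto simp: D_def)
    show "b \<in> B" by (simp add: B_def)
    show "(j, k) \<notin> F" if "j \<in> U - S - B" "k \<in> B" for j k
      using that by (auto simp: S_def)
    show "(s, t) \<in> F" if "s \<in> S" "t \<in> S" "s \<noteq> t" for s t
      using that by (rule clique)
  qed (auto simp: S_def)
qed

text \<open>Induction over the vertex set \<open>U\<close> with the graph kept fixed. If
  \<open>U\<close> is a clique, \<open>W\<close> itself serves. Otherwise a clique \<open>S\<close>
  separates two nonadjacent vertices \<open>a\<close> and \<open>b\<close>; both sides joined with
  \<open>S\<close> are proper subsets, their completions agree with \<open>W\<close> on all of
  \<open>S\<close>, and so they can be glued.\<close>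

theorem chordal_psd_completion:
  fixes F :: "(nat \<times> nat) set"
  assumes "finite U" and F: "sym F" "irrefl F" "chordal F"
    and "\<And>q. q \<subseteq> U \<Longrightarrow> (\<And>j k. j \<in> q \<Longrightarrow> k \<in> q \<Longrightarrow> j \<noteq> k \<Longrightarrow> (j, k) \<in> F) \<Longrightarrow> psd_on q W"
  shows "\<exists>M. psd_on U M \<and> (\<forall>j\<in>U. \<forall>k\<in>U. j = k \<or> (j, k) \<in> F \<longrightarrow> M (j, k) = W (j, k))"
  using assms(1,5)
proof (induction U rule: finite_psubset_induct)
  case (psubset U)
  note psd = psubset.prems
  show ?case
  proof (cases "\<exists>a\<in>U. \<exists>b\<in>U. a \<noteq> b \<and> (a, b) \<notin> F")
    case False
    then show ?thesis using psd[of U] by blast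
  next
    case True
    then obtain a b where ab: "a \<in> U" "b \<in> U" "a \<noteq> b" "(a, b) \<notin> F" by blast
    obtain A S B where U: "U = A \<union> S \<union> B" and disj: "A \<inter> S = {}" "A \<inter> B = {}" "S \<inter> B = {}"
      and "a \<in> A" "b \<in> B" and sep: "\<And>j k. j \<in> A \<Longrightarrow> k \<in> B \<Longrightarrow> (j, k) \<notin> F"
      and clique: "\<And>j k. j \<in> S \<Longrightarrow> k \<in> S \<Longrightarrow> j \<noteq> k \<Longrightarrow> (j, k) \<in> F"
      by (rule chordal_clique_separator[OF F ab]) (rule that)
    have fin: "finite A" "finite S" "finite B" using U psubset.hyps by auto
    have IH: "\<exists>M. psd_on V M \<and> (\<forall>j\<in>V. \<forall>k\<in>V. j = k \<or> (j, k) \<in> F \<longrightarrow> M (j, k) = W (j, k))"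
      if "V \<subset> U" for V
      using that by (intro psubset.IH psd) auto
    have "A \<union> S \<subset> U" "S \<union> B \<subset> U"
      using U disj \<open>a \<in> A\<close> \<open>b \<in> B\<close> by auto
    obtain M where M: "psd_on (A \<union> S) M"
      "\<And>j k. j \<in> A \<union> S \<Longrightarrow> k \<in> A \<union> S \<Longrightarrow> j = k \<or> (j, k) \<in> F \<Longrightarrow> M (j, k) = W (j, k)"
      using IH[OF \<open>A \<union> S \<subset> U\<close>] by blast
    obtain M' where M': "psd_on (S \<union> B) M'"
      "\<And>j k. j \<in> S \<union> B \<Longrightarrow> k \<in> S \<union> B \<Longrightarrow> j = k \<or> (j, k) \<in> F \<Longrightarrow> M' (j, k) = W (j, k)"
      using IH[OF \<open>S \<union> B \<subset> U\<close>] by blast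
    have agree: "M (j, k) = M' (j, k)" if "j \<in> S" "k \<in> S" for j k
    proof -
      have "j = k \<or> (j, k) \<in> F" using clique that by blast
      then show ?thesis using that M(2)[of j k] M'(2)[of j k] by simp
    qed
    obtain G where G: "psd_on (A \<union> S \<union> B) G"
      "\<And>j k. j \<in> A \<union> S \<Longrightarrow> k \<in> A \<union> S \<Longrightarrow> G (j, k) = M (j, k)"
      "\<And>j k. j \<in> S \<union> B \<Longrightarrow> k \<in> S \<union> B \<Longrightarrow> G (j, k) = M' (j, k)"
      by (rule psd_on_glue[OF M(1) M'(1) fin disj]) (use agree in blast, rule that)
    have "G (j, k) = W (j, k)" if jk: "j \<in> U" "k \<in> U" "j = k \<or> (j, k) \<in> F" for j k
    proof -
      \<comment> \<open>No edge runs between \<open>A\<close> and \<open>B\<close>, so each position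
        prescribed by \<open>W\<close> lies within one of the two glued matrices.\<close>
      have "\<not> (j \<in> A \<and> k \<in> B)" "\<not> (j \<in> B \<and> k \<in> A)"
        using jk(3) sep disj \<open>sym F\<close> by (auto dest: symD)
      then have "(j \<in> A \<union> S \<and> k \<in> A \<union> S) \<or> (j \<in> S \<union> B \<and> k \<in> S \<union> B)"
        using jk U by auto
      then show ?thesis
        using jk(3) G(2)[of j k] G(3)[of j k] M(2)[of j k] M'(2)[of j k] by metis
    qed
    then show ?thesis using G(1) U by blast
  qed
qed

section \<open>Comparison of the feasible sets\<close>

lemma submatrix_on_eq_iff:
  "submatrix_on n F W = submatrix_on n F W' \<longleftrightarrow> (\<forall>p\<in>positions n F. W p = W' p)"
  unfolding submatrix_on_def by (metis restrict_apply' restrict_ext)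

text \<open>The matrix for \<open>V\<close> is \<open>V V\<^sup>H\<close>: it is positive
  semidefinite of rank at most one, and its entries turn the power flow expressions in
  \<open>V\<close> into the linear ones in \<open>W\<close>.\<close>

lemma voltages_effective_subset_full:
  assumes "edges N \<subseteq> {0..last_bus N} \<times> {0..last_bus N}"
  shows "effective_subset (voltages N) (cost_voltage N C) (W_full N) (cost_full N C)"
  unfolding effective_subset_def
proof
  fix V assume V: "V \<in> voltages N"
  let ?n = "last_bus N"
  define W where "W = mat (?n + 1) (?n + 1) (\<lambda>(j, k). V $ j * cnj (V $ k))"
  have W: "W $$ (j, k) = V $ j * cnj (V $ k)" if "j \<le> ?n" "k \<le> ?n" for j k
    using that by (simp add: W_def)
  have pos: "j \<le> ?n" "k \<le> ?n" if "(j, k) \<in> positions ?n (edges N)" for j k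
    using that assms by (auto simp: positions_def)
  have sub: "network_submatrix N (($$) W) (j, k) = V $ j * cnj (V $ k)"
    if "(j, k) \<in> positions ?n (edges N)" for j k
    using that pos[OF that] W by (simp add: submatrix_on_def)
  have diag: "V $ j * cnj (V $ j) = of_real ((cmod (V $ j))\<^sup>2)" for j
    by (simp add: complex_norm_square[symmetric])
  have "psd_on {0..?n} (($$) W)"
    using psd_on_rank_one[of "{0..?n}" "\<lambda>j. V $ j"]
    by (subst psd_on_cong[where W' = "\<lambda>(j, k). V $ j * cnj (V $ k)"]) (auto simp: W)
  moreover have "operational N (network_submatrix N (($$) W))"
    unfolding operational_def
  proof
    fix j assume j: "j \<in> {0..?n}"
    have jj: "(j, j) \<in> positions ?n (edges N)" using j by (simp add: positions_def)
    have "(\<Sum>k | (j, k) \<in> edges N. cnj (admittance N j k) *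
        (network_submatrix N (($$) W) (j, j) - network_submatrix N (($$) W) (j, k))) =
      (\<Sum>k | (j, k) \<in> edges N. cnj (admittance N j k) * (V $ j) * (cnj (V $ j) - cnj (V $ k)))"
      using jj by (intro sum.cong) (auto simp: sub positions_def algebra_simps)
    then show "between (s_min N j) (\<Sum>k | (j, k) \<in> edges N. cnj (admittance N j k) *
        (network_submatrix N (($$) W) (j, j) - network_submatrix N (($$) W) (j, k))) (s_max N j) \<and>
      between (ereal (v_min N j), 0) (network_submatrix N (($$) W) (j, j)) (ereal (v_max N j), 0)"
      using V j jj by (simp add: voltages_def sub diag between_def)
  qed
  ultimately have "W \<in> W_full N" by (simp add: W_full_def W_def)
  moreover have "cost_voltage N C V = cost_full N C W"
    unfolding cost_voltage_def cost_full_def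
    using pos by (intro arg_cong[of _ _ C]) (auto simp: submatrix_on_eq_iff W diag)
  ultimately show "\<exists>W\<in>W_full N. cost_voltage N C V = cost_full N C W" by blast
qed

lemma full_effective_subset_chordal:
  assumes F: "simple_graph (last_bus N) F" "edges N \<subseteq> F"
  shows "effective_subset (W_full N) (cost_full N C) (W_chordal N F) (cost_partial N C)"
  unfolding effective_subset_def
proof
  fix W assume W: "W \<in> W_full N"
  let ?n = "last_bus N"
  define W' where "W' = submatrix_on ?n F (($$) W)"
  have psd: "psd_on {0..?n} (($$) W)" using W by (simp add: W_full_def)
  have pos: "positions ?n F \<subseteq> {0..?n} \<times> {0..?n}"
    using F by (auto simp: positions_def simple_graph_def)
  have sym: "(k, j) \<in> positions ?n F" if "(j, k) \<in> positions ?n F" for j k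
    using that F by (auto simp: positions_def simple_graph_def dest: symD)
  have "W' (k, j) = cnj (W' (j, k))" if "(j, k) \<in> positions ?n F" for j k
  proof -
    have "W $$ (k, j) = cnj (W $$ (j, k))"
      by (rule psd_on_hermitian[OF psd]) (use that pos in auto)
    then show ?thesis using that sym by (simp add: W'_def submatrix_on_def)
  qed
  then have "hermitian_on (positions ?n F) W'"
    by (auto simp: hermitian_on_def)
  moreover have "psd_on q W'" if q: "clique ?n F q" for q
  proof -
    have "psd_on q (($$) W)" using q by (intro psd_on_subset[OF psd]) (auto simp: clique_def)
    then show ?thesis
      using q by (subst psd_on_cong[where W' = "($$) W"])
        (auto simp: W'_def submatrix_on_def positions_def clique_def)
  qed
  moreover have sub: "network_submatrix N W' = network_submatrix N (($$) W)"
  proof -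
    \<comment> \<open>Restricting first to \<open>F\<close> and then to the network graph is
      restricting to the network graph at once, so constraints and cost are unchanged.\<close>
    have "positions ?n F \<inter> positions ?n (edges N) = positions ?n (edges N)"
      using F by (auto simp: positions_def)
    then show ?thesis by (simp add: W'_def submatrix_on_def)
  qed
  ultimately have "W' \<in> W_chordal N F"
    using W by (simp add: W_chordal_def W_full_def partial_psd_def partial_matrices_def)
      (simp add: W'_def submatrix_on_def)
  then show "\<exists>W'\<in>W_chordal N F. cost_full N C W = cost_partial N C W'"
    using sub by (intro bexI[of _ W']) (simp_all add: cost_full_def cost_partial_def)
qed

text \<open>A positive semidefinite completion keeps all entries on \<open>F\<close>, hence those on
  the network graph, which alone enter the operational constraints and the cost.\<close>

lemma chordal_effective_subset_full:
  assumes F: "chordal_extension (last_bus N) (edges N) F"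
  shows "effective_subset (W_chordal N F) (cost_partial N C) (W_full N) (cost_full N C)"
  unfolding effective_subset_def
proof
  fix W assume W: "W \<in> W_chordal N F"
  let ?n = "last_bus N"
  have "\<exists>M. psd_on {0..?n} M \<and>
      (\<forall>j\<in>{0..?n}. \<forall>k\<in>{0..?n}. j = k \<or> (j, k) \<in> F \<longrightarrow> M (j, k) = W (j, k))"
    using F W by (intro chordal_psd_completion)
      (auto simp: chordal_extension_def simple_graph_def W_chordal_def partial_psd_def clique_def)
  then obtain M where psd: "psd_on {0..?n} M"
    and M: "\<forall>j\<in>{0..?n}. \<forall>k\<in>{0..?n}. j = k \<or> (j, k) \<in> F \<longrightarrow> M (j, k) = W (j, k)"
    by blast
  define W' where "W' = mat (?n + 1) (?n + 1) M"
  have "psd_on {0..?n} (($$) W')"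
    using psd by (subst psd_on_cong[where W' = M]) (auto simp: W'_def)
  moreover have sub: "network_submatrix N (($$) W') = network_submatrix N W"
  proof -
    have "W' $$ (j, k) = W (j, k)" if "(j, k) \<in> positions ?n (edges N)" for j k
    proof -
      have "j \<le> ?n" "k \<le> ?n" "j = k \<or> (j, k) \<in> F"
        using that F by (auto simp: positions_def chordal_extension_def simple_graph_def)
      then show ?thesis using M[rule_format, of j k] by (simp add: W'_def)
    qed
    then show ?thesis by (auto simp: submatrix_on_eq_iff)
  qed
  ultimately have "W' \<in> W_full N"
    using W by (simp add: W_full_def W_chordal_def) (simp add: W'_def)
  then show "\<exists>W'\<in>W_full N. cost_partial N C W = cost_full N C W'"
    using sub by (intro bexI[of _ W']) (simp_all add: cost_full_def cost_partial_def)
qed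

text \<open>Each edge of the network is a two-element clique of \<open>F\<close>, so restriction to
  the network graph keeps the edge constraints.\<close>

lemma chordal_effective_subset_edge:
  assumes E: "simple_graph (last_bus N) (edges N)" and F: "edges N \<subseteq> F" "simple_graph (last_bus N) F"
  shows "effective_subset (W_chordal N F) (cost_partial N C) (W_edge N) (cost_partial N C)"
  unfolding effective_subset_def
proof
  fix W assume W: "W \<in> W_chordal N F"
  let ?n = "last_bus N" and ?W = "network_submatrix N W"
  have "sym (positions ?n (edges N))"
    using E by (auto simp: positions_def simple_graph_def sym_def)
  moreover have "positions ?n (edges N) \<subseteq> positions ?n F"
    using F by (auto simp: positions_def)
  moreover have "hermitian_on (positions ?n F) W"
    using W by (simp add: W_chordal_def partial_psd_def)
  ultimately have "hermitian_on (positions ?n (edges N)) ?W"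
    by (fastforce simp: hermitian_on_def submatrix_on_def dest: symD)
  moreover have "psd_on {j, k} ?W" if jk: "(j, k) \<in> edges N" for j k
  proof -
    have kj: "(k, j) \<in> edges N" "j \<le> ?n" "k \<le> ?n"
      using jk E by (auto simp: simple_graph_def dest: symD)
    then have "clique ?n F {j, k}" using jk F by (auto simp: clique_def)
    then have "psd_on {j, k} W" using W by (simp add: W_chordal_def partial_psd_def)
    then show ?thesis
      using jk kj by (subst psd_on_cong[where W' = W]) (auto simp: submatrix_on_def positions_def)
  qed
  ultimately have "?W \<in> W_edge N"
    using W by (auto simp: W_edge_def W_chordal_def partial_matrices_def submatrix_on_def)
  moreover have "network_submatrix N ?W = ?W"
    by (simp add: submatrix_on_def)
  ultimately show "\<exists>W'\<in>W_edge N. cost_partial N C W = cost_partial N C W'"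
    by (metis cost_partial_def)
qed

section \<open>Cliques and edge constraints in acyclic networks\<close>

lemma clique_acyclic:
  assumes F: "\<nexists>c. graph_cycle F c" and q: "clique n F q"
    and xyz: "x \<in> q" "y \<in> q" "z \<in> q"
  shows "x = y \<or> y = z \<or> x = z"
proof (rule ccontr)
  assume neq: "\<not> ?thesis"
  then have e: "(x, y) \<in> F" "(y, z) \<in> F" "(z, x) \<in> F"
    using q xyz unfolding clique_def by metis+
  have "([x, y, z] ! i, [x, y, z] ! (Suc i mod 3)) \<in> F" if i: "i < 3" for i
  proof -
    consider "i = 0" | "i = 1" | "i = 2" using i by linarith
    then show ?thesis by cases (simp_all add: e)
  qed
  then have "graph_cycle F [x, y, z]"
    using neq by (simp add: graph_cycle_def)
  then show False using F by blast
qed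

text \<open>Without cycles a clique has at most two vertices. Pairs are covered by the edge
  constraints; a single vertex is covered by the voltage bounds, which make its diagonal entry real
  and positive.\<close>

lemma edge_subset_chordal_acyclic:
  assumes N: "valid_network N" and acyclic: "\<nexists>c. graph_cycle (edges N) c"
  shows "W_edge N \<subseteq> W_chordal N (edges N)"
proof
  fix W assume W: "W \<in> W_edge N"
  let ?n = "last_bus N" and ?E = "edges N"
  have herm: "hermitian_on (positions ?n ?E) W" and op: "operational N W"
    using W by (auto simp: W_edge_def)
  have single: "psd_on {j} W" if j: "j \<le> ?n" for j
  proof -
    have "v_min N j \<le> Re (W (j, j))" "0 \<le> ereal (Im (W (j, j)))" "ereal (Im (W (j, j))) \<le> 0"
      using op j by (auto simp: operational_def between_def)
    moreover have "0 < v_min N j" using N j by (simp add: valid_network_def)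
    ultimately obtain w where "0 \<le> w" and w: "W (j, j) = complex_of_real w"
      by (intro that[of "Re (W (j, j))"]) (auto simp: complex_eq_iff)
    have "Re (cnj z * complex_of_real w * z) = w * ((Re z)\<^sup>2 + (Im z)\<^sup>2)" for z
      by (simp add: power2_eq_square algebra_simps)
    then have "0 \<le> Re (cnj z * complex_of_real w * z)" for z
      using \<open>0 \<le> w\<close> by (simp only: mult_nonneg_nonneg add_nonneg_nonneg zero_le_power2)
    then show ?thesis
      by (intro psd_onI) (simp_all add: w)
  qed
  have "psd_on q W" if q: "clique ?n ?E q" for q
  proof -
    note eq = clique_acyclic[OF acyclic q]
    consider "q = {}" | j where "q = {j}" | j k where "q = {j, k}" "j \<noteq> k"
    proof -
      show thesis if "q = {} \<Longrightarrow> thesis" "\<And>j. q = {j} \<Longrightarrow> thesis" "\<And>j k. q = {j, k} \<Longrightarrow> j \<noteq> k \<Longrightarrow> thesis"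
      proof (cases "\<exists>j\<in>q. \<exists>k\<in>q. j \<noteq> k")
        case True
        then obtain j k where "j \<in> q" "k \<in> q" "j \<noteq> k" by blast
        then have "q = {j, k}" using eq[of j k] by auto
        then show thesis using that(3) \<open>j \<noteq> k\<close> by blast
      next
        case False
        then show thesis using that(1,2) by (cases "q = {}") blast+
      qed
    qed
    then show ?thesis
    proof cases
      case 1
      then show ?thesis by (intro psd_onI) auto
    next
      case 2
      then show ?thesis using single q by (simp add: clique_def)
    next
      case 3
      then have "(j, k) \<in> ?E" using q by (simp add: clique_def)
      then show ?thesis using W 3 by (auto simp: W_edge_def)
    qed
  qed
  moreover have "network_submatrix N W = W"
    using W by (simp add: W_edge_def partial_matrices_def submatrix_on_def extensional_restrict)
  ultimately show "W \<in> W_chordal N ?E"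
    using W herm by (simp add: W_chordal_def W_edge_def partial_psd_def)
qed

lemma effective_subset_trans:
  "effective_subset A cA B cB \<Longrightarrow> effective_subset B cB D cD \<Longrightarrow> effective_subset A cA D cD"
  unfolding effective_subset_def by fastforce

theorem theorem5:
  fixes N :: network
    and F :: "(nat \<times> nat) set"
    and C :: "partial_matrix \<Rightarrow> real"
  assumes "valid_network N"
    and "chordal_extension (last_bus N) (edges N) F"
  shows "effective_subset (voltages N) (cost_voltage N C) (W_full N) (cost_full N C) \<and>
         effective_equal (W_full N) (cost_full N C) (W_chordal N F) (cost_partial N C) \<and>
         effective_subset (W_chordal N F) (cost_partial N C) (W_edge N) (cost_partial N C) \<and>
         (tree_graph (last_bus N) (edges N) \<longrightarrow>
            effective_subset (voltages N) (cost_voltage N C) (W_full N) (cost_full N C) \<and>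
            effective_equal (W_full N) (cost_full N C) (W_chordal N F) (cost_partial N C) \<and>
            effective_equal (W_chordal N F) (cost_partial N C) (W_edge N) (cost_partial N C))"
proof -
  have E: "simple_graph (last_bus N) (edges N)"
    using assms(1) by (simp add: valid_network_def)
  have F: "simple_graph (last_bus N) F" "edges N \<subseteq> F"
    using assms(2) by (auto simp: chordal_extension_def)
  have voltages: "effective_subset (voltages N) (cost_voltage N C) (W_full N) (cost_full N C)"
    using E by (intro voltages_effective_subset_full) (auto simp: simple_graph_def)
  note full_chordal = full_effective_subset_chordal[OF F, of C]
  note chordal_full = chordal_effective_subset_full[OF assms(2), of C]
  note chordal_edge = chordal_effective_subset_edge[OF E F(2,1), of C]
  have edge_chordal: "effective_subset (W_edge N) (cost_partial N C) (W_chordal N F) (cost_partial N C)"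
    if "tree_graph (last_bus N) (edges N)"
  proof -
    have acyclic: "\<nexists>c. graph_cycle (edges N) c" using that by (simp add: tree_graph_def)
    \<comment> \<open>A tree is vacuously chordal and thus extends itself, but \<open>F\<close> may
      have more edges. The passage from the edge set to \<open>F\<close> therefore goes through full
      matrices: complete on the tree, then restrict to \<open>F\<close>.\<close>
    then have ext: "chordal_extension (last_bus N) (edges N) (edges N)"
      using E by (simp add: chordal_extension_def chordal_def)
    have "effective_subset (W_edge N) (cost_partial N C) (W_chordal N (edges N)) (cost_partial N C)"
      using edge_subset_chordal_acyclic[OF assms(1) acyclic] unfolding effective_subset_def by blast
    then show ?thesis
      using chordal_effective_subset_full[OF ext] full_chordal by (blast intro: effective_subset_trans)
  qed
  show ?thesis
    using voltages full_chordal chordal_full chordal_edge edge_chordal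
    by (simp add: effective_equal_def)
qed

end
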